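(* Let $G$ be an undirected weighted connected graph on $n$ vertices in which every vertex has positive degree. Let $\epsilon>0$ and let $\lambda\in(0,2]$ be a lower bound on all non-zero eigenvalues of $L_G$. For any positive integers $T\ge\frac{\log(6/(\epsilon\lambda))}{\lambda}$, $N\ge\frac{6T}{\epsilon}$ and $K\ge\max(6T,\log(6T/\epsilon))$, and any vector $b\in\mathsf{Im}(L_G)$, \[ \Big\|\Big(L_G^\dagger-\frac{T}{N}\sum_{j=1}^{N}\sum_{k=0}^{K-1}\mathcal P_{jT/N}(k)\,D_G^{1/2}P_G^kD_G^{-1/2}\Big)b\Big\|\le\frac{\epsilon\|b\|}{2}. \]
   Context: $G$ has symmetric weights $w(i,j)\ge0$ ($>0$ exactly on edges), degrees $d_i=\sum_jw(i,j)$, degree matrix $D_G=\mathrm{diag}(d_1,\dots,d_n)$. The normalized Laplacian is $L_G=I-D_G^{1/2}P_GD_G^{-1/2}$ where $P_G[i,j]=w(i,j)/d_i$ is the transition matrix. $\mathsf{Im}(L_G)$ is the image of $L_G$ and $L_G^\dagger=\sum_{i:\lambda_i\ne0}\lambda_i^{-1}u_iu_i^t$ its pseudo-inverse (for an orthonormal eigenbasis $u_i$ with eigenvalues $\lambda_i$). $\log$ is the natural logarithm, $\|\cdot\|$ the Euclidean norm, and $\mathcal P_s(k)=e^{-s}s^k/k!$ is the Poisson distribution with parameter $s>0$. *)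

theory Defs
  imports "HOL-Analysis.Analysis" "HOL-Probability.Probability_Mass_Function"
begin

section \<open>Matrices\<close>

definition diag_mat :: "('n::finite \<Rightarrow> real) \<Rightarrow> real^'n^'n" where
  "diag_mat f = (\<chi> i j. if i = j then f i else 0)"

text \<open>The library's \<open>^\<close> on \<^typ>\<open>real^'n^'n\<close> is the entrywise power,
  not the one for matrix multiplication.\<close>

primrec matrix_pow :: "real^'n::finite^'n \<Rightarrow> nat \<Rightarrow> real^'n^'n" where
  "matrix_pow A 0 = mat 1"
| "matrix_pow A (Suc k) = A ** matrix_pow A k"

definition matrix_eigenvalue :: "real^'n::finite^'n \<Rightarrow> real \<Rightarrow> bool" where
  "matrix_eigenvalue A \<mu> \<longleftrightarrow> (\<exists>v. v \<noteq> 0 \<and> A *v v = \<mu> *\<^sub>R v)"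

text \<open>The basis is indexed by the coordinate type \<open>'n\<close>, so it has exactly \<open>CARD('n)\<close>
  members, and eigenvalues are listed with multiplicity.\<close>

definition orthonormal_eigenbasis ::
  "real^'n::finite^'n \<Rightarrow> ('n \<Rightarrow> real^'n) \<Rightarrow> ('n \<Rightarrow> real) \<Rightarrow> bool" where
  "orthonormal_eigenbasis A u \<mu> \<longleftrightarrow>
     (\<forall>i j. u i \<bullet> u j = (if i = j then 1 else 0)) \<and>
     (\<forall>i. A *v u i = \<mu> i *\<^sub>R u i)"

text \<open>Meaningful for symmetric \<open>A\<close> only: then an orthonormal eigenbasis exists (spectral theorem),
  and the sum does not depend on which one is chosen.\<close>

definition pseudo_inverse :: "real^'n::finite^'n \<Rightarrow> real^'n^'n" where
  "pseudo_inverse A =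
     (SOME X. \<exists>u \<mu>. orthonormal_eigenbasis A u \<mu> \<and>
        X = (\<Sum>i | \<mu> i \<noteq> 0. inverse (\<mu> i) *\<^sub>R ((columnvector (u i) :: real^1^'n) ** rowvector (u i))))"

section \<open>Weighted graphs\<close>

text \<open>An undirected weighted graph with vertex set \<open>'n\<close> is given by its weight function; the edges
  are the pairs of positive weight. Self-loops are allowed, and a loop at \<open>i\<close> contributes
  \<open>w i i\<close> once to the degree of \<open>i\<close>.\<close>

definition weighted_graph :: "('n::finite \<Rightarrow> 'n \<Rightarrow> real) \<Rightarrow> bool" where
  "weighted_graph w \<longleftrightarrow> (\<forall>i j. w i j = w j i) \<and> (\<forall>i j. w i j \<ge> 0)"

definition graph_edges :: "('n::finite \<Rightarrow> 'n \<Rightarrow> real) \<Rightarrow> ('n \<times> 'n) set" where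
  "graph_edges w = {(i, j). w i j > 0}"

definition graph_connected :: "('n::finite \<Rightarrow> 'n \<Rightarrow> real) \<Rightarrow> bool" where
  "graph_connected w \<longleftrightarrow> (\<forall>i j. (i, j) \<in> (graph_edges w)\<^sup>*)"

definition wdegree :: "('n::finite \<Rightarrow> 'n \<Rightarrow> real) \<Rightarrow> 'n \<Rightarrow> real" where
  "wdegree w i = (\<Sum>j\<in>UNIV. w i j)"

text \<open>\<open>degree_matrix_powr w a\<close> is the power \<open>D\<^sup>a\<close> of the degree matrix, which is
  diagonal with positive entries when all degrees are positive.\<close>

definition degree_matrix_powr :: "('n::finite \<Rightarrow> 'n \<Rightarrow> real) \<Rightarrow> real \<Rightarrow> real^'n^'n" where
  "degree_matrix_powr w a = diag_mat (\<lambda>i. wdegree w i powr a)"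

definition transition_matrix :: "('n::finite \<Rightarrow> 'n \<Rightarrow> real) \<Rightarrow> real^'n^'n" where
  "transition_matrix w = (\<chi> i j. w i j / wdegree w i)"

definition normalized_laplacian :: "('n::finite \<Rightarrow> 'n \<Rightarrow> real) \<Rightarrow> real^'n^'n" where
  "normalized_laplacian w =
     mat 1 - degree_matrix_powr w (1/2) ** transition_matrix w ** degree_matrix_powr w (-1/2)"

end

(* In an orthonormal eigenbasis of the Laplacian the error operator is diagonal, and b has no
   component along the kernel, so it suffices to bound the scalar error for a single eigenvalue m
   in [lam, 2]. There 1/m is the integral of exp(-mt) over t >= 0, the double sum is its Riemann sum
   over [0, T] with exp(-mt) expanded as a Poisson average of (1 - m)^k, and the tail of that
   expansion is controlled because |1 - m| <= 1. *)

theory Submission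
  imports Defs
begin

section \<open>The spectral theorem for real symmetric operators\<close>

text \<open>The quadratic form of \<open>f\<close> attains a maximum on the unit sphere of
  \<open>S\<close>, which is compact. At a maximizer the form cannot grow to first order, and this
  forces an eigenvector.\<close>

lemma selfadjoint_eigenvector_on_subspace:
  fixes f :: "'a::euclidean_space \<Rightarrow> 'a"
  assumes f: "linear f"
    and adj: "\<And>x y. f x \<bullet> y = x \<bullet> f y"
    and S: "subspace S" "\<And>x. x \<in> S \<Longrightarrow> f x \<in> S" "S \<noteq> {0}"
  obtains v \<mu> where "v \<in> S" "norm v = 1" "f v = \<mu> *\<^sub>R v"
proof -
  let ?K = "S \<inter> sphere 0 1"
  have "compact ?K"
    using closed_subspace[OF S(1)] by (simp add: closed_Int_compact)
  moreover have "?K \<noteq> {}"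
  proof -
    obtain x where "x \<in> S" "x \<noteq> 0"
      using S(1,3) subspace_0 by blast
    then have "(1 / norm x) *\<^sub>R x \<in> ?K"
      using S(1) by (simp add: subspace_scale)
    then show ?thesis by blast
  qed
  moreover have "continuous_on ?K (\<lambda>x. x \<bullet> f x)"
    by (intro continuous_intros linear_continuous_on linear_conv_bounded_linear[THEN iffD1] f)
  ultimately obtain v where v: "v \<in> ?K" and max: "\<And>y. y \<in> ?K \<Longrightarrow> y \<bullet> f y \<le> v \<bullet> f v"
    using continuous_attains_sup[of ?K "\<lambda>x. x \<bullet> f x"] by blast
  define \<mu> where "\<mu> = v \<bullet> f v"
  \<comment> \<open>Maximality of \<mu> makes \<open>g\<close> positive semidefinite on
    \<open>S\<close>, and the eigenvector equation for \<open>v\<close> becomes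
    \<open>g v = 0\<close>.\<close>
  define g where "g x = \<mu> *\<^sub>R x - f x" for x
  have v1: "v \<in> S" "norm v = 1" using v by auto
  have psd: "0 \<le> g y \<bullet> y" if "y \<in> S" for y
  proof (cases "y = 0")
    case False
    then have "(1 / norm y) *\<^sub>R y \<in> ?K"
      using S(1) that by (simp add: subspace_scale)
    from max[OF this] have "(y \<bullet> f y) / (norm y)\<^sup>2 \<le> \<mu>"
      by (simp add: linear_scale[OF f] \<mu>_def power2_eq_square)
    then have "y \<bullet> f y \<le> \<mu> * (y \<bullet> y)"
      using False by (simp add: divide_simps power2_norm_eq_inner)
    then show ?thesis
      by (simp add: g_def inner_diff_left) (simp add: inner_commute)
  qed (simp add: g_def linear_0[OF f])
  have gadj: "g x \<bullet> y = x \<bullet> g y" for x y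
    by (simp add: g_def inner_diff_left inner_diff_right adj)
  have glin: "linear g"
    by (rule linearI) (simp_all add: g_def linear_add[OF f] linear_scale[OF f] algebra_simps)
  have gv0: "g v \<bullet> v = 0"
    using v1 adj[of v v] by (simp add: g_def inner_diff_left \<mu>_def norm_eq_1)
  have gS: "g v \<in> S"
    using S v1 by (simp add: g_def subspace_diff subspace_scale)
  define a c where "a = g v \<bullet> g v" and "c = g (g v) \<bullet> g v"
  have c0: "c \<ge> 0" using psd[OF gS] by (simp add: c_def)
  \<comment> \<open>Moving from \<open>v\<close> against \<open>g v\<close> stays in
    \<open>S\<close>. Since the form of \<open>g\<close> vanishes at \<open>v\<close>, the quadratic
    in \<open>t\<close> has no constant term, so \<open>a > 0\<close> would make it negative for
    small \<open>t > 0\<close>.\<close>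
  have quad: "0 \<le> - 2 * t * a + t\<^sup>2 * c" for t
  proof -
    have "0 \<le> g (v - t *\<^sub>R g v) \<bullet> (v - t *\<^sub>R g v)"
      using psd S(1) v1 gS by (simp add: subspace_diff subspace_scale)
    also have "\<dots> = g v \<bullet> v - t * (g (g v) \<bullet> v) - t * (g v \<bullet> g v) + t\<^sup>2 * c"
      by (simp add: linear_diff[OF glin] linear_scale[OF glin] inner_diff_left inner_diff_right
          c_def power2_eq_square right_diff_distrib)
    also have "\<dots> = - 2 * t * a + t\<^sup>2 * c"
      by (simp add: gv0 gadj[of "g v" v] a_def)
    finally show ?thesis .
  qed
  have "a = 0"
  proof (rule ccontr)
    assume "a \<noteq> 0"
    then have a: "a > 0" by (simp add: a_def)
    \<comment> \<open>The minimizer would be \<open>a / c\<close>; the denominator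
      \<open>c + 1\<close> stays positive even when \<open>c = 0\<close>.\<close>
    have "0 \<le> - 2 * (a / (c + 1)) * a + (a / (c + 1))\<^sup>2 * c" by (rule quad)
    also have "\<dots> = - (a / (c + 1))\<^sup>2 * (c + 2)"
    proof -
      define r where "r = a / (c + 1)"
      have "a = r * (c + 1)" using c0 by (simp add: r_def)
      then have "- 2 * r * a + r\<^sup>2 * c = - r\<^sup>2 * (c + 2)"
        by (simp add: power2_eq_square algebra_simps)
      then show ?thesis by (simp add: r_def)
    qed
    also have "\<dots> < 0" using a c0 by simp
    finally show False by simp
  qed
  then have "f v = \<mu> *\<^sub>R v" by (simp add: a_def g_def)
  with v1 that show thesis by blast
qed

text \<open>Indexing by \<open>'n\<close> gives the family as many members as the dimension, so it
  spans. The remainder of the expansion is orthogonal to the whole span, hence to itself.\<close>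

lemma orthonormal_family_expansion:
  fixes u :: "'n::finite \<Rightarrow> real^'n"
  assumes on: "\<And>i j. u i \<bullet> u j = (if i = j then 1 else 0)"
  shows "x = (\<Sum>i\<in>UNIV. (u i \<bullet> x) *\<^sub>R u i)"
proof -
  have inj: "inj u"
    by (rule injI) (metis on zero_neq_one)
  have "pairwise orthogonal (range u)"
    by (auto simp: pairwise_def orthogonal_def on)
  moreover have "0 \<notin> range u"
    by (metis on imageE inner_zero_left zero_neq_one)
  ultimately have ind: "independent (range u)"
    by (rule pairwise_orthogonal_independent)
  have "card (range u) = dim (UNIV :: (real^'n) set)"
    using inj by (simp add: card_image)
  then have "span (range u) = UNIV"
    using card_eq_dim[of "range u" UNIV] ind by auto
  moreover have "orthogonal (x - (\<Sum>i\<in>UNIV. (u i \<bullet> x) *\<^sub>R u i)) y" if "y \<in> span (range u)" for y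
  proof (rule orthogonal_to_span[OF that])
    fix z assume "z \<in> range u"
    then obtain k where "z = u k" by blast
    then show "orthogonal (x - (\<Sum>i\<in>UNIV. (u i \<bullet> x) *\<^sub>R u i)) z"
      by (simp add: orthogonal_def inner_diff_left inner_sum_left on inner_commute[of x]
          if_distrib cong: if_cong)
  qed
  ultimately have "orthogonal (x - (\<Sum>i\<in>UNIV. (u i \<bullet> x) *\<^sub>R u i)) (x - (\<Sum>i\<in>UNIV. (u i \<bullet> x) *\<^sub>R u i))"
    by blast
  then show ?thesis by (simp add: orthogonal_self)
qed

lemma norm_orthonormal_sum:
  fixes u :: "'n::finite \<Rightarrow> 'a::real_inner"
  assumes on: "\<And>i j. u i \<bullet> u j = (if i = j then 1 else 0)"
  shows "(norm (\<Sum>i\<in>UNIV. a i *\<^sub>R u i))\<^sup>2 = (\<Sum>i\<in>UNIV. (a i)\<^sup>2)"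
  unfolding power2_norm_eq_inner
  by (simp add: inner_sum_left inner_sum_right on if_distrib power2_eq_square cong: if_cong)

text \<open>A maximal orthonormal set of eigenvectors is a basis: its orthogonal complement is invariant,
  hence would contain a further eigenvector.\<close>

lemma symmetric_orthonormal_eigenbasis:
  fixes A :: "real^'n::finite^'n"
  assumes sym: "transpose A = A"
  obtains u \<mu> where "orthonormal_eigenbasis A u \<mu>"
proof -
  have adj: "(A *v x) \<bullet> y = x \<bullet> (A *v y)" for x y
    by (metis sym dot_lmul_matrix vector_transpose_matrix)
  define E where "E B \<longleftrightarrow> pairwise orthogonal B \<and> (\<forall>v\<in>B. norm v = 1 \<and> (\<exists>\<mu>. A *v v = \<mu> *\<^sub>R v))"
    for B :: "(real^'n) set"
  have E_ind: "independent B" if "E B" for B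
    using that by (intro pairwise_orthogonal_independent) (auto simp: E_def)
  have "E {}" by (simp add: E_def)
  moreover have "\<forall>B. E B \<longrightarrow> card B \<le> CARD('n)"
    using E_ind independent_bound by fastforce
  ultimately obtain B where B: "E B" and max: "\<And>C. E C \<Longrightarrow> card C \<le> card B"
    using ex_has_greatest_nat[of E "{}" card "Suc CARD('n)"] by (auto simp: less_Suc_eq_le)
  define S where "S = {x. \<forall>v\<in>B. v \<bullet> x = 0}"
  have subS: "subspace S"
    by (auto simp: S_def subspace_def inner_add_right)
  have invS: "A *v x \<in> S" if "x \<in> S" for x
    unfolding S_def
  proof safe
    fix v assume v: "v \<in> B"
    then obtain \<mu> where "A *v v = \<mu> *\<^sub>R v" using B by (auto simp: E_def)
    then show "v \<bullet> (A *v x) = 0"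
      using that v by (simp add: S_def flip: adj)
  qed
  have "S = {0}"
  proof (rule ccontr)
    assume "S \<noteq> {0}"
    then obtain v \<mu> where v: "v \<in> S" "norm v = 1" "A *v v = \<mu> *\<^sub>R v"
      using selfadjoint_eigenvector_on_subspace[of "(*v) A" S] subS invS adj
      by (metis matrix_vector_mul_linear)
    have "v \<notin> B" using v by (auto simp: S_def)
    moreover have "E (insert v B)"
      using B v by (auto simp: E_def pairwise_insert S_def orthogonal_def inner_commute)
    moreover have "finite B" using E_ind[OF B] independent_imp_finite by blast
    ultimately show False using max[of "insert v B"] by simp
  qed
  have "span B = UNIV"
  proof -
    have "x \<in> span B" for x
    proof -
      \<comment> \<open>The component of \<open>x\<close> orthogonal to \<open>span B\<close> lies
        in \<open>S\<close>, which is trivial.\<close>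
      obtain y z where yz: "y \<in> span B" "\<And>w. w \<in> span B \<Longrightarrow> orthogonal z w" "x = y + z"
        using orthogonal_subspace_decomp_exists[of B x] by metis
      then have "z \<in> S"
        by (auto simp: S_def orthogonal_def inner_commute span_base)
      with \<open>S = {0}\<close> yz show ?thesis by simp
    qed
    then show ?thesis by blast
  qed
  then have card: "card B = CARD('n)"
    using E_ind[OF B] indep_card_eq_dim_span[of B] by simp
  moreover have "finite B" using E_ind[OF B] independent_imp_finite by blast
  ultimately obtain u where u: "bij_betw u (UNIV :: 'n set) B"
    using finite_same_card_bij[of "UNIV :: 'n set" B] by auto
  have uB: "u i \<in> B" for i using u by (auto simp: bij_betw_def)
  have "u i \<bullet> u j = (if i = j then 1 else 0)" for i j
  proof (cases "i = j")
    case True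
    then show ?thesis using B uB[of i] by (simp add: E_def norm_eq_1)
  next
    case False
    then have "u i \<noteq> u j" using u by (auto simp: bij_betw_def inj_def)
    then show ?thesis using B uB False by (auto simp: E_def pairwise_def orthogonal_def)
  qed
  moreover have "\<forall>i. \<exists>\<mu>. A *v u i = \<mu> *\<^sub>R u i"
    using B uB by (auto simp: E_def)
  then obtain \<mu> where "\<forall>i. A *v u i = \<mu> i *\<^sub>R u i"
    by (rule choice[THEN exE])
  ultimately have "orthonormal_eigenbasis A u \<mu>"
    by (auto simp: orthonormal_eigenbasis_def)
  then show thesis by (rule that)
qed

section \<open>Operators that are diagonal in an orthonormal basis\<close>

text \<open>Parseval's identity: each coordinate of \<open>b\<close> is scaled by
  \<open>g i\<close>. Only the directions in which \<open>b\<close> has a component matter, which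
  later removes the kernel of the Laplacian.\<close>

lemma norm_diagonal_matrix_le:
  fixes A :: "real^'n::finite^'n"
    and u :: "'n \<Rightarrow> real^'n"
  assumes on: "\<And>i j. u i \<bullet> u j = (if i = j then 1 else 0)"
    and diag: "\<And>i. A *v u i = g i *\<^sub>R u i"
    and bound: "\<And>i. u i \<bullet> b \<noteq> 0 \<Longrightarrow> \<bar>g i\<bar> \<le> C"
    and "0 \<le> C"
  shows "norm (A *v b) \<le> C * norm b"
proof -
  have b: "b = (\<Sum>i\<in>UNIV. (u i \<bullet> b) *\<^sub>R u i)"
    by (rule orthonormal_family_expansion[OF on])
  have "A *v b = (\<Sum>i\<in>UNIV. (u i \<bullet> b) *\<^sub>R (A *v u i))"
    by (subst b) (simp only: linear_sum[OF matrix_vector_mul_linear] matrix_vector_mult_scaleR)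
  then have "A *v b = (\<Sum>i\<in>UNIV. ((u i \<bullet> b) * g i) *\<^sub>R u i)"
    by (simp add: diag)
  then have "(norm (A *v b))\<^sup>2 = (\<Sum>i\<in>UNIV. ((u i \<bullet> b) * g i)\<^sup>2)"
    using norm_orthonormal_sum[OF on] by simp
  also have "\<dots> \<le> (\<Sum>i\<in>UNIV. C\<^sup>2 * (u i \<bullet> b)\<^sup>2)"
  proof (rule sum_mono)
    fix i
    have "(u i \<bullet> b) \<noteq> 0 \<Longrightarrow> (g i)\<^sup>2 \<le> C\<^sup>2"
      using bound[of i] by (metis abs_ge_zero power2_abs power_mono)
    then show "((u i \<bullet> b) * g i)\<^sup>2 \<le> C\<^sup>2 * (u i \<bullet> b)\<^sup>2"
      by (cases "u i \<bullet> b = 0") (simp_all add: power_mult_distrib mult.commute mult_right_mono)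
  qed
  also have "\<dots> = C\<^sup>2 * (norm b)\<^sup>2"
    using norm_orthonormal_sum[OF on, of "\<lambda>i. u i \<bullet> b"] b[symmetric]
    by (simp add: sum_distrib_left)
  finally have "(norm (A *v b))\<^sup>2 \<le> (C * norm b)\<^sup>2"
    by (simp add: power_mult_distrib)
  then show ?thesis
    by (rule power2_le_imp_le) (use \<open>0 \<le> C\<close> in simp)
qed

lemma linear_matrix_vector_mult_left: "linear (\<lambda>M :: real^'n::finite^'m::finite. M *v x)"
  by (rule linearI) (simp_all add: matrix_vector_mult_add_rdistrib scaleR_matrix_vector_assoc)

text \<open>The spectral theorem shows that the choice in \<open>pseudo_inverse\<close> has a
  witness. Keeping the basis behind the chosen matrix avoids comparing different eigenbases.\<close>

lemma pseudo_inverse_obtain_eigenbasis: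
  fixes A :: "real^'n::finite^'n"
  assumes "transpose A = A"
  obtains u \<mu> where "orthonormal_eigenbasis A u \<mu>"
    and "\<And>i. pseudo_inverse A *v u i = (if \<mu> i \<noteq> 0 then inverse (\<mu> i) else 0) *\<^sub>R u i"
proof -
  let ?P = "\<lambda>X u \<mu>. orthonormal_eigenbasis A u \<mu> \<and> X = (\<Sum>i | \<mu> i \<noteq> 0.
      inverse (\<mu> i) *\<^sub>R ((columnvector (u i) :: real^1^'n) ** rowvector (u i)))"
  have "\<exists>X u \<mu>. ?P X u \<mu>"
    using symmetric_orthonormal_eigenbasis[OF assms] by blast
  then have "\<exists>u \<mu>. ?P (pseudo_inverse A) u \<mu>"
    unfolding pseudo_inverse_def by (rule someI_ex)
  then obtain u \<mu> where e: "orthonormal_eigenbasis A u \<mu>"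
    and X: "pseudo_inverse A = (\<Sum>i | \<mu> i \<noteq> 0. inverse (\<mu> i) *\<^sub>R
      ((columnvector (u i) :: real^1^'n) ** rowvector (u i)))"
    by blast
  have on: "u i \<bullet> u j = (if i = j then 1 else 0)" for i j
    using e by (simp add: orthonormal_eigenbasis_def)
  \<comment> \<open>Each summand is a rank-one projection onto a basis vector, so on
    \<open>u k\<close> only the term \<open>i = k\<close> survives.\<close>
  have outer: "((columnvector v :: real^1^'n) ** rowvector v) *v x = (v \<bullet> x) *\<^sub>R v" for v x :: "real^'n"
    by (simp add: vec_eq_iff columnvector_def rowvector_def matrix_matrix_mult_def
        matrix_vector_mult_def inner_vec_def sum_distrib_left mult_ac)
  have "pseudo_inverse A *v u k = (if \<mu> k \<noteq> 0 then inverse (\<mu> k) else 0) *\<^sub>R u k" for k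
  proof -
    have "pseudo_inverse A *v u k = (\<Sum>i | \<mu> i \<noteq> 0. inverse (\<mu> i) *\<^sub>R (u i \<bullet> u k) *\<^sub>R u i)"
      unfolding X linear_sum[OF linear_matrix_vector_mult_left] linear_scale[OF linear_matrix_vector_mult_left] outer ..
    also have "\<dots> = (\<Sum>i | \<mu> i \<noteq> 0. if i = k then inverse (\<mu> k) *\<^sub>R u k else 0)"
      by (intro sum.cong) (simp_all add: on)
    finally show ?thesis by simp
  qed
  with e that show thesis by blast
qed

section \<open>Truncated and discretized exponentials\<close>

text \<open>This is the exponential series of \<open>s * x\<close> scaled by
  \<open>exp (- s)\<close>. The value \<open>x = 1 - \<mu>\<close> yields
  \<open>exp (- s * \<mu>)\<close>, and \<open>x = exp 1\<close> yields the tail bound.\<close>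

lemma poisson_generating_function:
  fixes s x :: real
  assumes "0 < s"
  shows "(\<lambda>k. pmf (poisson_pmf s) k * x ^ k) sums exp (s * (x - 1))"
proof -
  have "(\<lambda>k. exp (- s) * ((s * x) ^ k /\<^sub>R fact k)) sums (exp (- s) * exp (s * x))"
    by (intro sums_mult exp_converges)
  moreover have "exp (- s) * exp (s * x) = exp (s * (x - 1))"
    by (simp add: algebra_simps flip: exp_add)
  moreover have "exp (- s) * ((s * x) ^ k /\<^sub>R fact k) = pmf (poisson_pmf s) k * x ^ k" for k
    using assms by (simp add: power_mult_distrib divide_inverse mult_ac)
  ultimately show ?thesis by simp
qed

text \<open>Chernoff's bound with base \<open>e\<close>: terms of index at least \<open>K\<close> are multiplied by
  \<open>exp (k - K) \<ge> 1\<close>.\<close>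

lemma poisson_generating_function_tail:
  fixes s x :: real
  assumes s: "0 < s" and x: "\<bar>x\<bar> \<le> 1"
  shows "\<bar>exp (s * (x - 1)) - (\<Sum>k<K. pmf (poisson_pmf s) k * x ^ k)\<bar>
    \<le> exp (s * (exp 1 - 1) - real K)"
proof -
  define f where "f k = pmf (poisson_pmf s) k * x ^ k" for k
  define g where "g k = pmf (poisson_pmf s) k * exp 1 ^ k" for k
  have f: "f sums exp (s * (x - 1))"
    unfolding f_def by (rule poisson_generating_function[OF s])
  have g: "g sums exp (s * (exp 1 - 1))"
    unfolding g_def by (rule poisson_generating_function[OF s])
  have g0: "0 \<le> g k" for k by (simp add: g_def)
  have ftail: "exp (s * (x - 1)) - (\<Sum>k<K. f k) = (\<Sum>k. f (k + K))"
    using suminf_split_initial_segment[OF sums_summable[OF f], of K] sums_unique[OF f] by simp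
  have le: "norm (f (k + K)) \<le> exp (- real K) * g (k + K)" for k
  proof -
    have "\<bar>x\<bar> ^ (k + K) \<le> 1" using x by (simp add: power_le_one)
    also have "1 \<le> exp (- real K) * exp 1 ^ (k + K)"
      by (simp add: exp_of_nat_mult[symmetric] flip: exp_add)
    finally have "pmf (poisson_pmf s) (k + K) * \<bar>x\<bar> ^ (k + K)
        \<le> pmf (poisson_pmf s) (k + K) * (exp (- real K) * exp 1 ^ (k + K))"
      by (intro mult_left_mono) simp_all
    then show ?thesis
      unfolding f_def g_def real_norm_def abs_mult power_abs[symmetric]
      by (simp only: abs_of_nonneg[OF pmf_nonneg] power_abs mult_ac)
  qed
  have gK: "summable (\<lambda>k. g (k + K))"
    using sums_summable[OF g] by (simp only: summable_iff_shift)
  have "\<bar>\<Sum>k. f (k + K)\<bar> \<le> (\<Sum>k. exp (- real K) * g (k + K))"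
    using norm_suminf_le[OF le summable_mult[OF gK]] by simp
  also have "\<dots> = exp (- real K) * (\<Sum>k. g (k + K))"
    by (rule suminf_mult[OF gK])
  also have "(\<Sum>k. g (k + K)) \<le> exp (s * (exp 1 - 1))"
    using suminf_split_initial_segment[OF sums_summable[OF g], of K] sums_unique[OF g]
      sum_nonneg[of "{..<K}" g] g0 by simp
  also have "exp (- real K) * exp (s * (exp 1 - 1)) = exp (s * (exp 1 - 1) - real K)"
    by (simp flip: exp_add)
  finally show ?thesis
    using ftail by (simp add: f_def)
qed

text \<open>The right-endpoint sum is geometric, so its distance to \<open>1 / \<mu>\<close> can be
  computed without integrals. The term \<open>h\<close> is the discretization error and the last
  term the mass beyond time \<open>N * h\<close>.\<close>

lemma inverse_minus_riemann_sum_le: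
  fixes \<mu> h :: real
  assumes "0 < \<mu>" "0 < h"
  shows "\<bar>1 / \<mu> - h * (\<Sum>j=1..N. exp (- (real j * h * \<mu>)))\<bar> \<le> h + exp (- (real N * h * \<mu>)) / \<mu>"
proof -
  define q where "q = exp (- (h * \<mu>))"
  \<comment> \<open>The limit of the Riemann sum as \<open>N\<close> grows. The bound
    \<open>1 + x \<le> exp x\<close> at \<open>- h * \<mu>\<close> and at \<open>h * \<mu>\<close>
    places it between \<open>1 / \<mu> - h\<close> and \<open>1 / \<mu>\<close>.\<close>
  define a where "a = h * q / (1 - q)"
  have q: "0 < q" "q < 1" using assms by (simp_all add: q_def)
  have qn: "exp (- (real j * h * \<mu>)) = q ^ j" for j
    by (simp add: q_def mult.assoc flip: exp_of_nat_mult)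
  have "(\<Sum>j=1..N. exp (- (real j * h * \<mu>))) = (\<Sum>j=1..N. q ^ j)"
    by (simp add: qn)
  also have "\<dots> = q * (1 - q ^ N) / (1 - q)"
  proof (induction N)
    case (Suc N)
    have "(\<Sum>j=1..Suc N. q ^ j) = q * (1 - q ^ N) / (1 - q) + q ^ Suc N"
      by (simp only: sum.nat_ivl_Suc' Suc.IH)
    also have "\<dots> = q * (1 - q ^ Suc N) / (1 - q)"
      using q by (simp add: field_simps)
    finally show ?case .
  qed simp
  finally have S: "h * (\<Sum>j=1..N. exp (- (real j * h * \<mu>))) = a * (1 - q ^ N)"
    by (simp add: a_def)
  have "1 - h * \<mu> \<le> q"
    using exp_ge_add_one_self[of "- (h * \<mu>)"] by (simp add: q_def)
  then have lower: "1 / \<mu> \<le> h + a"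
    using q assms by (simp add: a_def field_simps)
  have "q * (1 + h * \<mu>) \<le> q * exp (h * \<mu>)"
    using q exp_ge_add_one_self[of "h * \<mu>"] by (intro mult_left_mono) simp_all
  also have "\<dots> = 1" by (simp add: q_def exp_minus)
  finally have upper: "a \<le> 1 / \<mu>"
    using q assms by (simp add: a_def field_simps)
  have a0: "0 \<le> a" using q assms by (simp add: a_def)
  have qN: "0 \<le> q ^ N" "q ^ N \<le> 1" using q by (simp_all add: power_le_one)
  have "a * q ^ N \<le> q ^ N / \<mu>"
    using mult_right_mono[OF upper qN(1)] by simp
  moreover have "0 \<le> a * q ^ N" using a0 qN by simp
  ultimately have "\<bar>1 / \<mu> - a * (1 - q ^ N)\<bar> \<le> h + q ^ N / \<mu>"
    using lower upper assms by (simp add: right_diff_distrib)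
  then show ?thesis unfolding S by (simp only: qn)
qed

text \<open>The three contributions to the error, each at most \<open>\<epsilon> / 6\<close>: cutting off
  \<open>1 / \<mu> = \<integral> exp (- \<mu> t) dt\<close> at time \<open>T\<close>, discretizing the integral with step \<open>T / N\<close>,
  and truncating the Poisson expansions at \<open>K\<close>. The Poisson tail is at most \<open>exp (- 4 T)\<close>, whereas the
  hypothesis on \<open>T\<close> forces \<open>\<epsilon> \<ge> 3 exp (- 2 T)\<close>.\<close>

lemma poisson_sum_approximates_inverse:
  fixes \<epsilon> lam \<mu> :: real and T N K :: nat
  assumes \<epsilon>: "0 < \<epsilon>" and lam: "0 < lam" "lam \<le> \<mu>" and \<mu>: "\<mu> \<le> 2"
    and pos: "0 < T" "0 < N"
    and T: "real T \<ge> ln (6 / (\<epsilon> * lam)) / lam"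
    and N: "real N \<ge> 6 * real T / \<epsilon>"
    and K: "real K \<ge> 6 * real T"
  shows "\<bar>1 / \<mu> - real T / real N *
      (\<Sum>j=1..N. \<Sum>k<K. pmf (poisson_pmf (real j * real T / real N)) k * (1 - \<mu>) ^ k)\<bar> \<le> \<epsilon> / 2"
proof -
  define h where "h = real T / real N"
  define p where "p j = (\<Sum>k<K. pmf (poisson_pmf (real j * real T / real N)) k * (1 - \<mu>) ^ k)" for j
  have h: "0 < h" "real N * h = real T" using pos by (simp_all add: h_def)
  have cut: "exp (- (lam * T)) / lam \<le> \<epsilon> / 6"
  proof -
    have "ln (6 / (\<epsilon> * lam)) \<le> lam * T"
      using T lam by (simp add: field_simps)
    then have "exp (ln (6 / (\<epsilon> * lam))) \<le> exp (lam * T)" by simp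
    then have "6 / (\<epsilon> * lam) \<le> exp (lam * T)"
      using \<epsilon> lam by simp
    then show ?thesis
      using \<epsilon> lam by (simp add: exp_minus field_simps)
  qed
  \<comment> \<open>The hypothesis on \<open>T\<close> concerns \<open>lam\<close>; monotonicity
    carries \<open>cut\<close> over to the larger values \<mu> and \<open>2\<close>.\<close>
  have mono: "exp (- (b * T)) / b \<le> exp (- (a * T)) / a" if "0 < a" "a \<le> b" for a b :: real
    using that by (intro frac_le) (simp_all add: mult_right_mono)
  have step: "h \<le> \<epsilon> / 6"
    using N \<epsilon> pos by (simp add: h_def field_simps)
  have trunc: "\<bar>exp (- (real j * h * \<mu>)) - p j\<bar> \<le> exp (- (4 * real T))" if "j \<in> {1..N}" for j
  proof -
    have j: "0 < real j * real T / real N" "real j * real T / real N \<le> real T"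
      using that pos by (simp_all add: field_simps)
    have "\<bar>1 - \<mu>\<bar> \<le> 1" using lam \<mu> by simp
    from poisson_generating_function_tail[OF j(1) this, of K]
    have "\<bar>exp (- (real j * h * \<mu>)) - p j\<bar> \<le> exp (real j * real T / real N * (exp 1 - 1) - real K)"
      by (simp add: p_def h_def)
    \<comment> \<open>Here \<open>exp 1 - 1 \<le> 2\<close> and the Poisson parameter is at most
      \<open>T\<close>, so \<open>K \<ge> 6 * T\<close> leaves an exponent of at most
      \<open>2 * T - 6 * T\<close>.\<close>
    also have "real j * real T / real N * (exp 1 - 1) \<le> real T * 2"
      using j exp_le by (intro mult_mono) simp_all
    then have "exp (real j * real T / real N * (exp 1 - 1) - real K) \<le> exp (- (4 * real T))"
      using K by simp
    finally show ?thesis .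
  qed
  have "\<bar>h * (\<Sum>j=1..N. exp (- (real j * h * \<mu>))) - h * (\<Sum>j=1..N. p j)\<bar>
      = h * \<bar>\<Sum>j=1..N. exp (- (real j * h * \<mu>)) - p j\<bar>"
    using h by (simp add: sum_subtractf abs_mult flip: right_diff_distrib)
  also have "\<dots> \<le> h * (\<Sum>j=1..N. exp (- (4 * real T)))"
    using h trunc by (intro mult_left_mono order.trans[OF sum_abs] sum_mono) simp_all
  also have "\<dots> = real T * exp (- (4 * real T))"
    using h(2) by (simp add: mult.assoc[symmetric] mult.commute[of h])
  \<comment> \<open>The shape \<open>exp (- (b * T)) / b\<close> with \<open>b = 2\<close> is
    produced so that \<open>mono\<close> and \<open>cut\<close> apply.\<close>
  also have "\<dots> \<le> exp (- (2 * real T)) / 2"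
  proof -
    have "2 * real T \<le> exp (2 * real T)"
      using exp_ge_add_one_self[of "2 * real T"] by linarith
    then have "2 * real T * exp (- (4 * real T)) \<le> exp (2 * real T) * exp (- (4 * real T))"
      by (intro mult_right_mono) simp_all
    then show ?thesis by (simp flip: exp_add)
  qed
  also have "\<dots> \<le> \<epsilon> / 6"
    using lam \<mu> by (intro order.trans[OF mono cut]) simp_all
  finally have "\<bar>h * (\<Sum>j=1..N. exp (- (real j * h * \<mu>))) - h * (\<Sum>j=1..N. p j)\<bar> \<le> \<epsilon> / 6" .
  moreover have "\<bar>1 / \<mu> - h * (\<Sum>j=1..N. exp (- (real j * h * \<mu>)))\<bar> \<le> h + exp (- (\<mu> * T)) / \<mu>"
    using inverse_minus_riemann_sum_le[of \<mu> h N] lam h by (simp add: mult.commute)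
  moreover have "exp (- (\<mu> * T)) / \<mu> \<le> \<epsilon> / 6"
    using lam by (intro order.trans[OF mono cut])
  ultimately have "\<bar>1 / \<mu> - h * (\<Sum>j=1..N. p j)\<bar> \<le> \<epsilon> / 2"
    using step by linarith
  then show ?thesis by (simp add: p_def h_def)
qed

section \<open>The normalized Laplacian\<close>

lemma diag_mat_mult_nth: "(diag_mat f ** A) $ i $ j = f i * A $ i $ j"
  by (simp add: diag_mat_def matrix_matrix_mult_def if_distrib[of "\<lambda>c. c * _"] cong: if_cong)

lemma mult_diag_mat_nth: "(A ** diag_mat f) $ i $ j = A $ i $ j * f j"
  by (simp add: diag_mat_def matrix_matrix_mult_def if_distrib[of "\<lambda>c. _ * c"] cong: if_cong)

lemma diag_mat_mult_vec_nth: "(diag_mat f *v x) $ i = f i * x $ i"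
  by (simp add: diag_mat_def matrix_vector_mult_def if_distrib[of "\<lambda>c. c * _"] cong: if_cong)

text \<open>Conjugation by the square root of the degrees turns the entry
  \<open>w i j / wdegree w i\<close> into \<open>w i j\<close> over the geometric mean of both
  degrees, which is symmetric.\<close>

lemma transpose_normalized_laplacian:
  assumes "weighted_graph w" and "\<And>i. wdegree w i > 0"
  shows "transpose (normalized_laplacian w) = normalized_laplacian w"
proof -
  have "wdegree w i powr (1/2) / wdegree w i = wdegree w i powr (-1/2)" for i
    using assms(2)[of i] powr_diff[of "wdegree w i" "1/2" 1] by simp
  then have "(degree_matrix_powr w (1/2) ** transition_matrix w ** degree_matrix_powr w (-1/2)) $ i $ j
      = wdegree w i powr (-1/2) * w i j * wdegree w j powr (-1/2)" for i j
    by (simp add: degree_matrix_powr_def mult_diag_mat_nth diag_mat_mult_nth transition_matrix_def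
        flip: times_divide_eq_left)
  moreover have "w i j = w j i" for i j
    using assms(1) by (simp add: weighted_graph_def)
  ultimately show ?thesis
    by (simp add: normalized_laplacian_def transpose_def vec_eq_iff mat_def mult_ac)
qed

lemma matrix_pow_eigenvector:
  assumes "A *v y = c *\<^sub>R y"
  shows "matrix_pow A k *v y = c ^ k *\<^sub>R y"
  by (induction k) (simp_all add: assms matrix_vector_mult_scaleR mult.commute
      flip: matrix_vector_mul_assoc)

text \<open>At a coordinate of largest modulus, \<open>P\<close> returns a weighted average of
  entries that are no larger in modulus.\<close>

lemma stochastic_eigenvalue_abs_le_1:
  fixes P :: "real^'n::finite^'n"
  assumes nonneg: "\<And>i j. 0 \<le> P $ i $ j" and row: "\<And>i. (\<Sum>j\<in>UNIV. P $ i $ j) = 1"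
    and eig: "P *v y = c *\<^sub>R y" and "y \<noteq> 0"
  shows "\<bar>c\<bar> \<le> 1"
proof -
  define m where "m = Max (range (\<lambda>i. \<bar>y $ i\<bar>))"
  have le: "\<bar>y $ i\<bar> \<le> m" for i by (simp add: m_def)
  have "m \<in> range (\<lambda>i. \<bar>y $ i\<bar>)" unfolding m_def by (rule Max_in) auto
  then obtain i where i: "m = \<bar>y $ i\<bar>" by blast
  obtain j where "y $ j \<noteq> 0" using \<open>y \<noteq> 0\<close> by (auto simp: vec_eq_iff)
  then have "0 < m" using le[of j] by linarith
  have "\<bar>c\<bar> * m = \<bar>(P *v y) $ i\<bar>"
    by (simp add: eig i abs_mult)
  also have "\<dots> = \<bar>\<Sum>j\<in>UNIV. P $ i $ j * y $ j\<bar>"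
    by (simp add: matrix_vector_mult_def)
  also have "\<dots> \<le> (\<Sum>j\<in>UNIV. P $ i $ j * m)"
    using nonneg le by (intro order.trans[OF sum_abs] sum_mono) (simp add: abs_mult mult_left_mono)
  also have "\<dots> = m" by (simp add: row flip: sum_distrib_right)
  finally show ?thesis using \<open>0 < m\<close> by simp
qed

text \<open>The identity minus the Laplacian is similar to the transition matrix, so eigenvectors
  correspond under the diagonal scaling and \<mu> becomes \<open>1 - \<mu>\<close>.\<close>

lemma transition_eigenvector_of_laplacian:
  assumes deg: "\<And>i. wdegree w i > 0"
    and eig: "normalized_laplacian w *v u = \<mu> *\<^sub>R u"
  defines "y \<equiv> degree_matrix_powr w (-1/2) *v u"
  shows "transition_matrix w *v y = (1 - \<mu>) *\<^sub>R y" and "degree_matrix_powr w (1/2) *v y = u"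
proof -
  have inv: "wdegree w i powr (1/2) * wdegree w i powr (-1/2) = 1"
      "wdegree w i powr (-1/2) * wdegree w i powr (1/2) = 1" for i
    using deg[of i] by (simp_all flip: powr_add)
  have DD: "degree_matrix_powr w (1/2) *v (degree_matrix_powr w (-1/2) *v x) = x"
      "degree_matrix_powr w (-1/2) *v (degree_matrix_powr w (1/2) *v x) = x" for x
    unfolding vec_eq_iff degree_matrix_powr_def diag_mat_mult_vec_nth
    by (simp_all only: mult.assoc[symmetric] inv mult_1_left simp_thms)
  show "degree_matrix_powr w (1/2) *v y = u" unfolding y_def by (rule DD)
  have "normalized_laplacian w *v u = u - degree_matrix_powr w (1/2) *v (transition_matrix w *v y)"
    by (simp add: normalized_laplacian_def y_def matrix_vector_mult_diff_rdistrib
        matrix_vector_mul_assoc matrix_mul_assoc)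
  then have "degree_matrix_powr w (1/2) *v (transition_matrix w *v y) = (1 - \<mu>) *\<^sub>R u"
    using eig by (simp add: algebra_simps)
  then have "degree_matrix_powr w (-1/2) *v (degree_matrix_powr w (1/2) *v (transition_matrix w *v y))
      = (1 - \<mu>) *\<^sub>R y"
    by (simp only: y_def matrix_vector_mult_scaleR)
  then show "transition_matrix w *v y = (1 - \<mu>) *\<^sub>R y" by (simp only: DD)
qed

text \<open>The number \<open>1 - \<mu>\<close> is an eigenvalue of a row-stochastic matrix.\<close>

lemma laplacian_eigenvalue_le_2:
  assumes "weighted_graph w" and deg: "\<And>i. wdegree w i > 0"
    and eig: "normalized_laplacian w *v u = \<mu> *\<^sub>R u" and "u \<noteq> 0"
  shows "\<mu> \<le> 2"
proof -
  define y where "y = degree_matrix_powr w (-1/2) *v u"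
  note y = transition_eigenvector_of_laplacian[OF deg eig, folded y_def]
  have "y \<noteq> 0" using y(2) \<open>u \<noteq> 0\<close> by auto
  have "(\<Sum>j\<in>UNIV. transition_matrix w $ i $ j) = 1" for i
    using deg[of i] by (simp add: transition_matrix_def wdegree_def flip: sum_divide_distrib)
  moreover have "0 \<le> transition_matrix w $ i $ j" for i j
    using assms(1) deg[of i] by (simp add: transition_matrix_def weighted_graph_def)
  ultimately have "\<bar>1 - \<mu>\<bar> \<le> 1"
    using stochastic_eigenvalue_abs_le_1 y(1) \<open>y \<noteq> 0\<close> by blast
  then show ?thesis by simp
qed

section \<open>Reduction of the operator bound to single eigenvalues\<close>

theorem theorem3:
  fixes w :: "'n::finite \<Rightarrow> 'n \<Rightarrow> real"
    and \<epsilon> lam :: real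
    and T N K :: nat
    and b :: "real^'n"
  assumes "weighted_graph w"
    and "graph_connected w"
    and "\<And>i. wdegree w i > 0"
    and "\<epsilon> > 0"
    and "0 < lam" and "lam \<le> 2"
    and "\<And>\<mu>. matrix_eigenvalue (normalized_laplacian w) \<mu> \<Longrightarrow> \<mu> \<noteq> 0 \<Longrightarrow> lam \<le> \<mu>"
    and "T > 0" and "N > 0" and "K > 0"
    and "real T \<ge> ln (6 / (\<epsilon> * lam)) / lam"
    and "real N \<ge> 6 * real T / \<epsilon>"
    and "real K \<ge> max (6 * real T) (ln (6 * real T / \<epsilon>))"
    and "b \<in> range ((*v) (normalized_laplacian w))"
  shows "norm ((pseudo_inverse (normalized_laplacian w)
           - (real T / real N) *\<^sub>R
             (\<Sum>j=1..N. \<Sum>k<K. pmf (poisson_pmf (real j * real T / real N)) k *\<^sub>R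
                (degree_matrix_powr w (1/2) ** matrix_pow (transition_matrix w) k
                   ** degree_matrix_powr w (-1/2)))) *v b)
         \<le> \<epsilon> * norm b / 2"
proof -
  let ?L = "normalized_laplacian w"
  let ?M = "\<lambda>k. degree_matrix_powr w (1/2) ** matrix_pow (transition_matrix w) k
    ** degree_matrix_powr w (-1/2)"
  let ?p = "\<lambda>j k. pmf (poisson_pmf (real j * real T / real N)) k"
  let ?A = "pseudo_inverse ?L - (real T / real N) *\<^sub>R (\<Sum>j=1..N. \<Sum>k<K. ?p j k *\<^sub>R ?M k)"
  have sym: "transpose ?L = ?L"
    by (rule transpose_normalized_laplacian) (fact assms)+
  obtain u \<mu> where e: "orthonormal_eigenbasis ?L u \<mu>"
    and pinv: "\<And>i. pseudo_inverse ?L *v u i = (if \<mu> i \<noteq> 0 then inverse (\<mu> i) else 0) *\<^sub>R u i"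
    using pseudo_inverse_obtain_eigenbasis[OF sym] by blast
  have on: "u i \<bullet> u j = (if i = j then 1 else 0)" for i j
    using e by (simp add: orthonormal_eigenbasis_def)
  have eig: "?L *v u i = \<mu> i *\<^sub>R u i" for i
    using e by (simp add: orthonormal_eigenbasis_def)
  have u0: "u i \<noteq> 0" for i
    using on[of i i] by auto
  have walk: "?M k *v u i = (1 - \<mu> i) ^ k *\<^sub>R u i" for k i
  proof -
    note y = transition_eigenvector_of_laplacian[OF assms(3) eig[of i]]
    have "?M k *v u i = degree_matrix_powr w (1/2) *v
        (matrix_pow (transition_matrix w) k *v (degree_matrix_powr w (-1/2) *v u i))"
      by (simp only: matrix_vector_mul_assoc matrix_mul_assoc)
    also have "\<dots> = (1 - \<mu> i) ^ k *\<^sub>R u i"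
      unfolding matrix_pow_eigenvector[OF y(1)] matrix_vector_mult_scaleR y(2) ..
    finally show ?thesis .
  qed
  \<comment> \<open>The diagonal entries of the error. Where \<open>\<mu> i = 0\<close> only the
    double sum remains, and it need not be small.\<close>
  define g where "g i = (if \<mu> i \<noteq> 0 then inverse (\<mu> i) else 0)
    - real T / real N * (\<Sum>j=1..N. \<Sum>k<K. ?p j k * (1 - \<mu> i) ^ k)" for i
  have diag: "?A *v u i = g i *\<^sub>R u i" for i
    unfolding linear_diff[OF linear_matrix_vector_mult_left] linear_scale[OF linear_matrix_vector_mult_left] linear_sum[OF linear_matrix_vector_mult_left] walk pinv g_def
      scaleR_scaleR scaleR_sum_left[symmetric] scaleR_diff_left ..
  have bound: "\<bar>g i\<bar> \<le> \<epsilon> / 2" if "u i \<bullet> b \<noteq> 0" for i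
  proof -
    obtain x where x: "b = ?L *v x" using assms by blast
    \<comment> \<open>Moving the symmetric Laplacian onto \<open>u i\<close> gives the factor
      \<open>\<mu> i\<close>, so \<open>b\<close> has no component along the kernel.\<close>
    have "u i \<bullet> b = (?L *v u i) \<bullet> x"
      unfolding x by (metis sym dot_lmul_matrix vector_transpose_matrix)
    then have "\<mu> i \<noteq> 0" using that by (auto simp: eig)
    moreover have "matrix_eigenvalue ?L (\<mu> i)"
      unfolding matrix_eigenvalue_def using eig u0 by blast
    ultimately have "lam \<le> \<mu> i" using assms by blast
    moreover have "\<mu> i \<le> 2"
      using laplacian_eigenvalue_le_2[OF assms(1,3) eig u0] .
    ultimately show ?thesis
      using poisson_sum_approximates_inverse[of \<epsilon> lam "\<mu> i" T N K] assms \<open>\<mu> i \<noteq> 0\<close>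
      by (simp add: g_def inverse_eq_divide)
  qed
  have "norm (?A *v b) \<le> \<epsilon> / 2 * norm b"
    using norm_diagonal_matrix_le[OF on diag bound] assms(4) by simp
  then show ?thesis by simp
qed

end
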